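(* Let $\mathfrak{H},\mathfrak{K},\mathfrak{L}$ be finite-dimensional Hilbert spaces equipped with error bases $\mathcal{E},\mathcal{F},\mathcal{E}'$ respectively. For $A\in L(\mathfrak{H},\mathfrak{K})$ and $B\in L(\mathfrak{K},\mathfrak{L})$ we have $\mathbf{C}(BA)=\mathbf{C}(A)\,\mathbf{C}(B)$ (matrix product); that is, for all $E\in\mathcal{E}$ and $E'\in\mathcal{E}'$, $$C(BA)^{E}_{E'}=\sum_{F\in\mathcal{F}}C(A)^{E}_{F}\;C(B)^{F}_{E'}.$$
   Context: Error basis: an error basis on a Hilbert space $\mathfrak{H}$ is a basis $\mathcal{E}$ of $L(\mathfrak{H})$ consisting of unitary operators, such that $I\in\mathcal{E}$; $\mathrm{Tr}(E^\dagger F)=0$ for distinct $E,F\in\mathcal{E}$; and $EF=\omega(E,F)FE$ for all $E,F\in\mathcal{E}$, where $\omega(E,F)\in\mathbb{C}$ satisfies $\omega(E,F)^r=1$ for some fixed $r$. $L(\mathfrak{H},\mathfrak{K})$ is the space of linear operators from $\mathfrak{H}$ to $\mathfrak{K}$. Fix an orthonormal basis $\{|x\rangle\}$ of each Hilbert space, with respect to which complex conjugates $E^*$ are taken. For $A\in L(\mathfrak{H},\mathfrak{K})$ the Choi state is $|T_A\rangle=\frac{1}{\sqrt{\dim\mathfrak{H}}}\sum_x|x\rangle\otimes A|x\rangle\in\mathfrak{H}\otimes\mathfrak{K}$. The circuit tensor of $A$ has entries $C(A)^E_{F}=\mathrm{Tr}((E^*\otimes F)|T_A\rangle\langle T_A|)$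 for $E\in\mathcal{E}$, $F\in\mathcal{F}$, and $\mathbf{C}(A)$ denotes the matrix with rows indexed by $\mathcal{E}$, columns by $\mathcal{F}$, and these entries. *)

theory Defs
  imports "HOL-Analysis.Analysis"
begin

text \<open>
  A finite-dimensional Hilbert space with a fixed orthonormal basis indexed by \<open>'h\<close> is rendered
  as \<open>complex ^ 'h\<close>, the basis vector \<open>|x\<rangle>\<close> being \<open>axis x 1\<close>. An operator from
  \<open>complex ^ 'h\<close> to \<open>complex ^ 'k\<close> is its matrix in these bases, of type
  \<open>complex ^ 'h ^ 'k\<close> (rows indexed by \<open>'k\<close>), and the tensor product of the two spaces is
  \<open>complex ^ ('h \<times> 'k)\<close>, with basis vectors \<open>|x\<rangle> \<otimes> |y\<rangle>\<close> indexed by pairs \<open>(x, y)\<close>.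
\<close>

definition mscale :: "complex \<Rightarrow> complex ^ 'n ^ 'm \<Rightarrow> complex ^ 'n ^ 'm" where
  "mscale c A = map_matrix (\<lambda>z. c * z) A"

text \<open>
  Linear independence and span of operators are over the complex numbers; the unqualified
  \<open>independent\<close> and \<open>span\<close> would be over the reals.
\<close>

interpretation cmat: vector_space "mscale :: complex \<Rightarrow> complex ^ 'n ^ 'm \<Rightarrow> complex ^ 'n ^ 'm"
  by unfold_locales (simp_all add: mscale_def map_matrix_def vec_eq_iff algebra_simps)

definition mconj :: "complex ^ 'n ^ 'm \<Rightarrow> complex ^ 'n ^ 'm" where
  "mconj A = map_matrix cnj A"

definition dagger :: "complex ^ 'n ^ 'm \<Rightarrow> complex ^ 'm ^ 'n" where
  "dagger A = mconj (transpose A)"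

definition unitary :: "complex ^ 'n ^ 'n \<Rightarrow> bool" where
  "unitary U \<longleftrightarrow> dagger U ** U = mat 1 \<and> U ** dagger U = mat 1"

definition error_basis :: "(complex ^ 'n ^ 'n) set \<Rightarrow> bool" where
  "error_basis \<E> \<longleftrightarrow>
     cmat.independent \<E> \<and> cmat.span \<E> = UNIV \<and>
     (\<forall>E\<in>\<E>. unitary E) \<and>
     mat 1 \<in> \<E> \<and>
     (\<forall>E\<in>\<E>. \<forall>F\<in>\<E>. E \<noteq> F \<longrightarrow> trace (dagger E ** F) = 0) \<and>
     (\<exists>r::nat. r > 0 \<and>
        (\<forall>E\<in>\<E>. \<forall>F\<in>\<E>. \<exists>\<omega>. E ** F = mscale \<omega> (F ** E) \<and> \<omega> ^ r = 1))"

definition tensor_vec :: "complex ^ 'h \<Rightarrow> complex ^ 'k \<Rightarrow> complex ^ ('h \<times> 'k)" where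
  "tensor_vec u v = (\<chi> p. u $ fst p * v $ snd p)"

definition tensor_op ::
  "complex ^ 'h ^ 'h1 \<Rightarrow> complex ^ 'k ^ 'k1 \<Rightarrow> complex ^ ('h \<times> 'k) ^ ('h1 \<times> 'k1)" where
  "tensor_op A B = (\<chi> p q. A $ fst p $ fst q * B $ snd p $ snd q)"

text \<open>The operator \<open>|u\<rangle>\<langle>v|\<close>.\<close>

definition ketbra :: "complex ^ 'm \<Rightarrow> complex ^ 'n \<Rightarrow> complex ^ 'n ^ 'm" where
  "ketbra u v = (\<chi> i j. u $ i * cnj (v $ j))"

definition choi_state :: "complex ^ 'h ^ 'k \<Rightarrow> complex ^ ('h \<times> 'k)" where
  "choi_state A =
     complex_of_real (1 / sqrt (real CARD('h))) *s
       (\<Sum>x\<in>UNIV. tensor_vec (axis x 1) (A *v axis x 1))"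

definition circuit_tensor ::
  "complex ^ 'h ^ 'k \<Rightarrow> complex ^ 'h ^ 'h \<Rightarrow> complex ^ 'k ^ 'k \<Rightarrow> complex" where
  "circuit_tensor A E F =
     trace (tensor_op (mconj E) F ** ketbra (choi_state A) (choi_state A))"

end

theory Submission
  imports Defs
begin

text \<open>
  With \<open>n\<close> the dimension of \<open>\<HH>\<close>, a direct computation gives \<open>C(A)\<^sup>E\<^sub>F = Tr(A E\<^sup>\<dagger> A\<^sup>\<dagger> F) / n\<close>. An error basis
  is orthogonal for the Hilbert--Schmidt inner product, so every operator has the expansion
  \<open>X = \<Sum>\<^sub>F Tr(F\<^sup>\<dagger> X) / k \<cdot> F\<close>. Applied to \<open>X = B\<^sup>\<dagger> E' B\<close>, whose coefficients are \<open>C(B)\<^sup>F\<^sub>E\<^sub>'\<close>,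
  it turns \<open>Tr(A E\<^sup>\<dagger> A\<^sup>\<dagger> X) / n\<close> into the claimed sum.
\<close>

lemma dagger_nth [simp]: "dagger A $ i $ j = cnj (A $ j $ i)"
  by (simp add: dagger_def mconj_def map_matrix_def transpose_def)

lemma dagger_mult: "dagger (A ** B) = dagger B ** dagger A"
  by (simp add: vec_eq_iff matrix_matrix_mult_def mult.commute)

lemma mscale_nth [simp]: "mscale c A $ i $ j = c * A $ i $ j"
  by (simp add: mscale_def map_matrix_def)

lemma matrix_mult_mscale: "M ** mscale c A = mscale c (M ** A)"
  by (simp add: vec_eq_iff matrix_matrix_mult_def sum_distrib_left mult_ac)

lemma trace_mscale: "trace (mscale c A) = c * trace A"
  by (simp add: trace_def sum_distrib_left)

lemma trace_mult_sum_mscale: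
  "trace (M ** (\<Sum>G\<in>S. mscale (u G) G)) = (\<Sum>G\<in>S. u G * trace (M ** G))"
  by (induction S rule: infinite_finite_induct)
     (simp_all add: matrix_add_ldistrib trace_add trace_0[unfolded mat_0] 
        matrix_mult_mscale trace_mscale)

lemma sum_UNIV_prod: "(\<Sum>p\<in>UNIV. f p) = (\<Sum>x\<in>UNIV. \<Sum>y\<in>UNIV. f (x, y))"
  by (simp add: sum.cartesian_product)

lemma choi_state_nth:
  fixes A :: "complex ^ 'h ^ 'k"
  shows "choi_state A $ (x, y) = A $ y $ x / complex_of_real (sqrt (real CARD('h)))"
  by (simp add: choi_state_def tensor_vec_def axis_def matrix_vector_mult_def if_distrib
      if_distribR cong: if_cong)

text \<open>The vector \<open>choi_state A\<close> is \<open>A\<close> flattened and normalised.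
  Summing over both index pairs contracts \<open>mconj E\<close> with its indices in transposed
  order, which is why \<open>dagger E\<close> appears.\<close>

lemma circuit_tensor_eq_trace:
  fixes A :: "complex ^ 'h ^ 'k"
  shows "circuit_tensor A E F = trace (A ** dagger E ** dagger A ** F) / of_nat CARD('h)"
proof -
  let ?s = "complex_of_real (sqrt (real CARD('h)))"
  \<comment> \<open>The ket and the bra each carry a factor \<open>1 / ?s\<close>; together they
    give the division by the dimension.\<close>
  have s: "?s * ?s = of_nat CARD('h)"
    by (simp flip: of_real_mult)
  have "circuit_tensor A E F = (\<Sum>x\<in>UNIV. \<Sum>y\<in>UNIV. \<Sum>x'\<in>UNIV. \<Sum>y'\<in>UNIV.
      cnj (E $ x $ x') * F $ y $ y' * (A $ y' $ x' / ?s) * (cnj (A $ y $ x) / ?s))"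
    by (simp add: circuit_tensor_def trace_def matrix_matrix_mult_def tensor_op_def ketbra_def
        mconj_def map_matrix_def choi_state_nth sum_UNIV_prod mult.assoc)
  also have "\<dots> = (\<Sum>x\<in>UNIV. \<Sum>y\<in>UNIV. \<Sum>x'\<in>UNIV. \<Sum>y'\<in>UNIV.
      A $ y' $ x' * cnj (E $ x $ x') * cnj (A $ y $ x) * F $ y $ y') / of_nat CARD('h)"
    unfolding s[symmetric] by (simp add: sum_divide_distrib mult_ac)
  \<comment> \<open>The new order y', y, x, x' is the one in which the left-nested product under the
    trace unfolds.\<close>
  also have "(\<Sum>x\<in>UNIV. \<Sum>y\<in>UNIV. \<Sum>x'\<in>UNIV. \<Sum>y'\<in>UNIV.
      A $ y' $ x' * cnj (E $ x $ x') * cnj (A $ y $ x) * F $ y $ y') =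
      (\<Sum>y'\<in>UNIV. \<Sum>y\<in>UNIV. \<Sum>x\<in>UNIV. \<Sum>x'\<in>UNIV.
      A $ y' $ x' * cnj (E $ x $ x') * cnj (A $ y $ x) * F $ y $ y')"
    (is "(\<Sum>x\<in>UNIV. \<Sum>y\<in>UNIV. \<Sum>x'\<in>UNIV. \<Sum>y'\<in>UNIV. ?f x y x' y') = _")
  proof -
    have "(\<Sum>x\<in>UNIV. \<Sum>y\<in>UNIV. \<Sum>x'\<in>UNIV. \<Sum>y'\<in>UNIV. ?f x y x' y') =
        (\<Sum>x\<in>UNIV. \<Sum>y\<in>UNIV. \<Sum>y'\<in>UNIV. \<Sum>x'\<in>UNIV. ?f x y x' y')"
      by (intro sum.cong refl sum.swap)
    also have "\<dots> = (\<Sum>x\<in>UNIV. \<Sum>y'\<in>UNIV. \<Sum>y\<in>UNIV. \<Sum>x'\<in>UNIV. ?f x y x' y')"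
      by (intro sum.cong refl sum.swap)
    also have "\<dots> = (\<Sum>y'\<in>UNIV. \<Sum>x\<in>UNIV. \<Sum>y\<in>UNIV. \<Sum>x'\<in>UNIV. ?f x y x' y')"
      by (rule sum.swap)
    also have "\<dots> = (\<Sum>y'\<in>UNIV. \<Sum>y\<in>UNIV. \<Sum>x\<in>UNIV. \<Sum>x'\<in>UNIV. ?f x y x' y')"
      by (intro sum.cong refl sum.swap)
    finally show ?thesis .
  qed
  also have "\<dots> = trace (A ** dagger E ** dagger A ** F)"
    by (simp add: trace_def matrix_matrix_mult_def sum_distrib_right)
  finally show ?thesis .
qed

text \<open>Turns trace orthogonality into orthogonality in the real Euclidean space of matrices,
  where facts about orthogonal sets apply.\<close>

lemma inner_eq_Re_trace: "E \<bullet> F = Re (trace (dagger E ** F))"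
proof -
  have "trace (dagger E ** F) = (\<Sum>i\<in>UNIV. \<Sum>j\<in>UNIV. cnj (E $ i $ j) * F $ i $ j)"
    unfolding trace_def matrix_matrix_mult_def by (simp, rule sum.swap)
  then show ?thesis
    by (simp add: inner_vec_def inner_complex_def)
qed

lemma trace_dagger_unitary:
  fixes U :: "complex ^ 'n ^ 'n"
  assumes "unitary U"
  shows "trace (dagger U ** U) = of_nat CARD('n)"
  using assms by (simp add: unitary_def trace_I)

text \<open>Nonzero pairwise orthogonal matrices are linearly independent over the reals, so finite
  dimension bounds their number. Sums over the basis would otherwise default to 0.\<close>

lemma error_basis_finite:
  assumes "error_basis \<E>"
  shows "finite \<E>"
proof -
  have "pairwise orthogonal \<E>"
    using assms by (auto simp: error_basis_def pairwise_def orthogonal_def inner_eq_Re_trace)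
  \<comment> \<open>For the zero matrix the trace would be 0, but unitarity makes it the positive
    dimension.\<close>
  moreover have "0 \<notin> \<E>"
  proof
    assume "0 \<in> \<E>"
    then have "unitary (0 :: complex ^ 'a ^ 'a)"
      using assms by (simp add: error_basis_def)
    from trace_dagger_unitary[OF this] show False
      by (simp add: trace_0[unfolded mat_0])
  qed
  ultimately show ?thesis
    by (intro independent_imp_finite pairwise_orthogonal_independent)
qed

lemma error_basis_expansion:
  fixes X :: "complex ^ 'n ^ 'n"
  assumes "error_basis \<E>"
  shows "X = (\<Sum>E\<in>\<E>. mscale (trace (dagger E ** X) / of_nat CARD('n)) E)"
proof -
  have fin: "finite \<E>"
    using assms by (rule error_basis_finite)
  have "X \<in> cmat.span \<E>"
    using assms by (simp add: error_basis_def)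
  then obtain u where X: "X = (\<Sum>E\<in>\<E>. mscale (u E) E)"
    using cmat.span_finite[OF fin] by auto
  \<comment> \<open>Pairing with \<open>dagger E\<close> isolates \<open>u E\<close>: orthogonality
    kills the other terms, and unitarity gives E the squared norm \<open>CARD('n)\<close>.\<close>
  have "u E = trace (dagger E ** X) / of_nat CARD('n)" if E: "E \<in> \<E>" for E
  proof -
    have "trace (dagger E ** X) = (\<Sum>G\<in>\<E>. u G * trace (dagger E ** G))"
      unfolding X by (rule trace_mult_sum_mscale)
    also have "\<dots> = (\<Sum>G\<in>\<E>. if G = E then u E * of_nat CARD('n) else 0)"
      using assms E by (intro sum.cong) (auto simp: error_basis_def trace_dagger_unitary)
    also have "\<dots> = u E * of_nat CARD('n)"
      using fin E by simp
    finally show ?thesis by simp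
  qed
  then have "(\<Sum>E\<in>\<E>. mscale (u E) E) =
      (\<Sum>E\<in>\<E>. mscale (trace (dagger E ** X) / of_nat CARD('n)) E)"
    by (intro sum.cong) auto
  with X show ?thesis
    by (rule trans)
qed

theorem theorem12:
  fixes \<E> :: "(complex ^ 'h ^ 'h) set"
    and \<F> :: "(complex ^ 'k ^ 'k) set"
    and \<E>' :: "(complex ^ 'l ^ 'l) set"
    and A :: "complex ^ 'h ^ 'k"
    and B :: "complex ^ 'k ^ 'l"
  assumes "error_basis \<E>" and "error_basis \<F>" and "error_basis \<E>'"
  shows "\<forall>E\<in>\<E>. \<forall>E'\<in>\<E>'.
    circuit_tensor (B ** A) E E' =
      (\<Sum>F\<in>\<F>. circuit_tensor A E F * circuit_tensor B F E')"
proof (intro ballI)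
  fix E :: "complex ^ 'h ^ 'h" and E' :: "complex ^ 'l ^ 'l"
  \<comment> \<open>Cyclicity of the trace moves the leading \<open>B\<close> to the end, so that
    everything involving \<open>B\<close> and \<open>E'\<close> gathers in \<open>?X\<close> and the
    rest in \<open>?M\<close>.\<close>
  let ?X = "dagger B ** E' ** B"
  let ?M = "A ** dagger E ** dagger A"
  have coeff: "circuit_tensor B F E' = trace (dagger F ** ?X) / of_nat CARD('k)" for F
    unfolding circuit_tensor_eq_trace
    using trace_mul_sym[of B "dagger F ** dagger B ** E'"] by (simp add: matrix_mul_assoc)
  have "circuit_tensor (B ** A) E E' = trace (?M ** ?X) / of_nat CARD('h)"
    unfolding circuit_tensor_eq_trace dagger_mult
    using trace_mul_sym[of B "?M ** dagger B ** E'"] by (simp add: matrix_mul_assoc)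
  also have "?X = (\<Sum>F\<in>\<F>. mscale (circuit_tensor B F E') F)"
    unfolding coeff by (rule error_basis_expansion[OF assms(2)])
  \<comment> \<open>By linearity each F contributes \<open>trace (?M ** F)\<close>, which divided by
    \<open>CARD('h)\<close> is \<open>circuit_tensor A E F\<close>.\<close>
  also have "trace (?M ** \<dots>) / of_nat CARD('h) =
      (\<Sum>F\<in>\<F>. circuit_tensor A E F * circuit_tensor B F E')"
    unfolding trace_mult_sum_mscale circuit_tensor_eq_trace[of A]
    by (simp add: sum_divide_distrib mult.commute)
  finally show "circuit_tensor (B ** A) E E' =
      (\<Sum>F\<in>\<F>. circuit_tensor A E F * circuit_tensor B F E')" .
qed

end
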